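(* (i) Let $b$ be an integer and let $(h_n)_{n\ge 0}$ be an elliptic divisibility sequence with $h_0=0$, $h_1=1$, $h_2=0$, $h_3=-b^2$, $h_4=0$. Then for every odd positive integer $n$, \[h_n=\varepsilon\, b^{(n^2-1)/4},\qquad \varepsilon=\begin{cases}+1 & n\equiv 1,5 \pmod 8,\\ -1 & n\equiv 3,7\pmod 8.\end{cases}\] (ii) Let $a_3$ be an integer and let $(h_n)_{n\ge 0}$ be an elliptic divisibility sequence with $h_0=0$, $h_1=1$, $h_2=a_3$, $h_3=0$, $h_4=-a_3^5$. Then for every positive integer $n$ not divisible by $3$, \[h_n=\varepsilon\, a_3^{(n^2-1)/3},\qquad \varepsilon=\begin{cases}+1 & n\equiv 1,2 \pmod 6,\\ -1 & n\equiv 4,5\pmod 6.\end{cases}\]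
   Context: An elliptic divisibility sequence (EDS) is a sequence $(h_n)_{n\ge0}$ of integers satisfying $h_{m+n}h_{m-n}=h_{m+1}h_{m-1}h_n^2-h_{n+1}h_{n-1}h_m^2$ for all integers $m\ge n\ge 1$, and such that $h_n$ divides $h_m$ whenever $n$ divides $m$. *)

theory Defs
  imports Main
begin

definition elliptic_divisibility_sequence :: "(nat \<Rightarrow> int) \<Rightarrow> bool" where
  "elliptic_divisibility_sequence h \<longleftrightarrow>
     (\<forall>m n. 1 \<le> n \<and> n \<le> m \<longrightarrow>
        h (m + n) * h (m - n) =
          h (m + 1) * h (m - 1) * h n ^ 2 - h (n + 1) * h (n - 1) * h m ^ 2) \<and>
     (\<forall>m n. n dvd m \<longrightarrow> h n dvd h m)"

end

theory Submission imports Defs begin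

text \<open>
  The cases \<open>(k + 1, k)\<close> and \<open>(k + 1, k - 1)\<close> of the defining relation
  express \<open>h (2k + 1)\<close> and \<open>h (2k) * h 2\<close> through terms of index about \<open>k\<close>.
  Divisibility forces \<open>h\<close> to vanish at all multiples of 2 (respectively 3), so in each residue
  class only one monomial of the relevant recursion survives, and strong induction gives the closed
  form. In the second case one has to divide by \<open>h 2\<close>, so \<open>h 2 = 0\<close> is treated apart.
\<close>

lemma eds_eq_zero_if_dvd:
  assumes "elliptic_divisibility_sequence h" "h d = 0" "d dvd n"
  shows "h n = 0"
  using assms unfolding elliptic_divisibility_sequence_def by (metis dvd_0_left)

lemma eds_odd_recursion:
  assumes "elliptic_divisibility_sequence h" "h 1 = 1" "1 \<le> k"
  shows "h (2 * k + 1) = h (k + 2) * h k ^ 3 - h (k - 1) * h (k + 1) ^ 3"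
proof -
  have "h ((k + 1) + k) * h ((k + 1) - k) =
      h ((k + 1) + 1) * h ((k + 1) - 1) * h k ^ 2 - h (k + 1) * h (k - 1) * h (k + 1) ^ 2"
    using assms unfolding elliptic_divisibility_sequence_def by (meson le_add1)
  moreover have "(k + 1) + k = 2 * k + 1" "(k + 1) - k = 1" "(k + 1) + 1 = k + 2" "(k + 1) - 1 = k"
    by simp_all
  ultimately show ?thesis
    using assms(2) by (simp only:) (simp add: power2_eq_square power3_eq_cube mult_ac)
qed

lemma eds_even_recursion:
  assumes "elliptic_divisibility_sequence h" "2 \<le> k"
  shows "h (2 * k) * h 2 = h k * (h (k + 2) * h (k - 1) ^ 2 - h (k - 2) * h (k + 1) ^ 2)"
proof -
  have "1 \<le> k - 1 \<and> k - 1 \<le> k + 1"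
    using assms(2) by auto
  then have "h ((k + 1) + (k - 1)) * h ((k + 1) - (k - 1)) =
      h ((k + 1) + 1) * h ((k + 1) - 1) * h (k - 1) ^ 2
        - h ((k - 1) + 1) * h ((k - 1) - 1) * h (k + 1) ^ 2"
    using assms(1) unfolding elliptic_divisibility_sequence_def by blast
  moreover have "(k + 1) + (k - 1) = 2 * k" "(k + 1) - (k - 1) = 2" "(k + 1) + 1 = k + 2"
    "(k + 1) - 1 = k" "(k - 1) + 1 = k" "(k - 1) - 1 = k - 2"
    using assms(2) by simp_all
  ultimately show ?thesis
    by (simp only:) (simp add: algebra_simps)
qed

text \<open>This lemma and the next merge a product of signed monomials into a single one, with
  shapes matching the odd and the even recursion. What remains of an inductive step is a parity
  check on the sign and a polynomial identity between exponents.\<close>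

lemma signed_power_mult:
  fixes x :: "'a::comm_ring_1"
  shows "(- 1) ^ i * x ^ p * ((- 1) ^ j * x ^ q) ^ k = (- 1) ^ (i + j * k) * x ^ (p + q * k)"
  by (simp add: power_mult_distrib power_add mult_ac flip: power_mult)

lemma signed_power_mult_mult:
  fixes x :: "'a::comm_ring_1"
  shows "(- 1) ^ l * x ^ r * ((- 1) ^ i * x ^ p * ((- 1) ^ j * x ^ q) ^ k) =
    (- 1) ^ (l + i + j * k) * x ^ (r + p + q * k)"
  by (simp add: power_mult_distrib power_add mult_ac flip: power_mult)

text \<open>With n = 2j + 1 the exponent (n^2 - 1)/4 becomes j^2 + j and the sign depends only on
  the parity of j, so the induction runs over j without division. In the recursion for
  \<open>h (2 * j + 1)\<close> the first term vanishes for even j and the second for odd j.\<close>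

lemma eds_two_torsion:
  fixes b :: int
  assumes eds: "elliptic_divisibility_sequence h"
    and h1: "h 1 = 1" and h2: "h 2 = 0" and h3: "h 3 = - (b ^ 2)"
  shows "h (2 * j + 1) = (- 1) ^ j * b ^ (j * j + j)"
proof (induction j rule: less_induct)
  case (less j)
  \<comment> \<open>The value at j = 1 has to come from the hypothesis on \<open>h 3\<close>, since
    the recursion with k = 1 only returns \<open>h 3\<close> itself. From j = 2 on, the surviving
    terms have smaller j.\<close>
  consider "j = 0" | "j = 1" | i where "j = 2 * i + 2" | i where "j = 2 * i + 3"
  proof -
    assume *: "j = 0 \<Longrightarrow> thesis" "j = 1 \<Longrightarrow> thesis"
      "\<And>i. j = 2 * i + 2 \<Longrightarrow> thesis" "\<And>i. j = 2 * i + 3 \<Longrightarrow> thesis"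
    have "j = 0 \<or> j = 1 \<or> j = 2 * ((j - 2) div 2) + 2 \<or> j = 2 * ((j - 3) div 2) + 3"
      by presburger
    then show thesis using * by blast
  qed
  then show ?case
  proof cases
    case 1
    then show ?thesis using h1 by simp
  next
    case 2
    then show ?thesis using h3 by (simp add: numeral_3_eq_3 numeral_2_eq_2)
  next
    case (3 i)
    have "h (j + 2) = 0"
      using 3 by (intro eds_eq_zero_if_dvd[OF eds h2]) simp
    then have "h (2 * j + 1) = - (h (2 * i + 1) * h (2 * (i + 1) + 1) ^ 3)"
      using eds_odd_recursion[OF eds h1, of j] 3 by (simp add: numeral_3_eq_3)
    also have "\<dots> = - ((- 1) ^ i * b ^ (i * i + i) *
        ((- 1) ^ (i + 1) * b ^ ((i + 1) * (i + 1) + (i + 1))) ^ 3)"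
      using less.IH[of i] less.IH[of "i + 1"] 3 by simp
    also have "\<dots> = - ((- 1) ^ (i + (i + 1) * 3) *
        b ^ (i * i + i + ((i + 1) * (i + 1) + (i + 1)) * 3))"
      by (simp only: signed_power_mult mult_minus_right)
    also have "\<dots> = (- 1) ^ j * b ^ (j * j + j)"
    \<comment> \<open>The sign exponent 4i + 3 is odd, so the leading minus cancels it, in agreement
      with j = 2i + 2 being even.\<close>
    proof -
      have "i * i + i + ((i + 1) * (i + 1) + (i + 1)) * 3 = j * j + j"
        using 3 by (simp add: algebra_simps)
      then show ?thesis
        using 3 by (simp only:) (simp add: minus_one_power_iff)
    qed
    finally show ?thesis .
  next
    case (4 i)
    have "h (j - 1) = 0"
      using 4 by (intro eds_eq_zero_if_dvd[OF eds h2]) simp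
    moreover have "j + 2 = 2 * (i + 2) + 1" "j = 2 * (i + 1) + 1"
      using 4 by simp_all
    ultimately have "h (2 * j + 1) = h (2 * (i + 2) + 1) * h (2 * (i + 1) + 1) ^ 3"
      using eds_odd_recursion[OF eds h1, of j] by simp
    also have "\<dots> = (- 1) ^ (i + 2) * b ^ ((i + 2) * (i + 2) + (i + 2)) *
        ((- 1) ^ (i + 1) * b ^ ((i + 1) * (i + 1) + (i + 1))) ^ 3"
      using less.IH[of "i + 2"] less.IH[of "i + 1"] 4 by simp
    also have "\<dots> = (- 1) ^ (i + 2 + (i + 1) * 3) *
        b ^ ((i + 2) * (i + 2) + (i + 2) + ((i + 1) * (i + 1) + (i + 1)) * 3)"
      by (simp only: signed_power_mult mult_minus_right)
    also have "\<dots> = (- 1) ^ j * b ^ (j * j + j)"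
      using 4 by (simp add: algebra_simps minus_one_power_iff flip: power_Suc)
    finally show ?thesis .
  qed
qed

text \<open>This serves the degenerate case a = 0 of the second part. Odd indices fall under
  \<open>eds_two_torsion\<close> with b = 0, where the exponent is positive for j > 0.\<close>

lemma eds_eq_zero_beyond_one:
  assumes eds: "elliptic_divisibility_sequence h"
    and h1: "h 1 = 1" and h2: "h 2 = 0" and h3: "h 3 = 0" and n: "1 < n"
  shows "h n = 0"
proof (cases "even n")
  case True
  then show ?thesis by (rule eds_eq_zero_if_dvd[OF eds h2])
next
  case False
  then obtain j where j: "n = 2 * j + 1" by (elim oddE)
  then show ?thesis
    using eds_two_torsion[OF eds h1 h2, of 0 j] h3 n by simp
qed

text \<open>The exponents are (n^2 - 1)/3 for n = 3j + 1 and n = 3j + 2. Both classes go through one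
  induction because each recursion mixes them. The parity of j decides which of the two indices is
  odd; the other one needs the even recursion and cancellation of \<open>h 2\<close>.\<close>

lemma eds_three_torsion:
  fixes a :: int
  assumes eds: "elliptic_divisibility_sequence h"
    and h1: "h 1 = 1" and h2: "h 2 = a" and h3: "h 3 = 0" and h4: "h 4 = - (a ^ 5)"
    and a: "a \<noteq> 0"
  shows "h (3 * j + 1) = (- 1) ^ j * a ^ (3 * j * j + 2 * j) \<and>
    h (3 * j + 2) = (- 1) ^ j * a ^ (3 * j * j + 4 * j + 1)"
proof (induction j rule: less_induct)
  case (less j)
  note zero = eds_eq_zero_if_dvd[OF eds h3]
  have cancel: "x = y" if "x * h 2 = y * a" for x y
    using that a h2 by simp
  consider "j = 0" | "j = 1" | i where "j = 2 * i + 2" | i where "j = 2 * i + 3"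
  proof -
    assume *: "j = 0 \<Longrightarrow> thesis" "j = 1 \<Longrightarrow> thesis"
      "\<And>i. j = 2 * i + 2 \<Longrightarrow> thesis" "\<And>i. j = 2 * i + 3 \<Longrightarrow> thesis"
    have "j = 0 \<or> j = 1 \<or> j = 2 * ((j - 2) div 2) + 2 \<or> j = 2 * ((j - 3) div 2) + 3"
      by presburger
    then show thesis using * by blast
  qed
  then show ?case
  proof cases
    case 1
    then show ?thesis using h1 h2 by (simp add: numeral_2_eq_2)
  next
    case 2
    have "h 5 = - (a ^ 8)"
      using eds_odd_recursion[OF eds h1, of 2] h2 h3 h4 by simp
    then show ?thesis using 2 h4 by simp
  next
    case (3 i)
    \<comment> \<open>For even j the odd recursion is used at k = 3i + 3 and the even one at k = 3i
      + 4. In both, a multiple of 3 among the indices kills the first product.\<close>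
    let ?p = "(- 1) ^ i * a ^ (3 * i * i + 4 * i + 1)"
    let ?q = "(- 1) ^ (i + 1) * a ^ (3 * (i + 1) * (i + 1) + 2 * (i + 1))"
    let ?r = "(- 1) ^ (i + 1) * a ^ (3 * (i + 1) * (i + 1) + 4 * (i + 1) + 1)"
    have ih: "h (3 * i + 2) = ?p" "h (3 * i + 4) = ?q" "h (3 * i + 5) = ?r"
      using less.IH[of i] less.IH[of "i + 1"] 3 by (simp_all add: add.commute)
    have idx: "2 * (3 * i + 3) + 1 = 3 * j + 1" "2 * (3 * i + 4) = 3 * j + 2"
      using 3 by simp_all
    have z: "h (3 * i + 3) = 0" "h (3 * i + 6) = 0"
      by (intro zero; presburger)+
    have "h (3 * j + 1) = - (?p * ?q ^ 3)"
      using eds_odd_recursion[OF eds h1, of "3 * i + 3"] ih z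
      unfolding idx by (simp add: add.commute)
    also have "\<dots> = - ((- 1) ^ (i + (i + 1) * 3) *
        a ^ (3 * i * i + 4 * i + 1 + (3 * (i + 1) * (i + 1) + 2 * (i + 1)) * 3))"
      by (simp only: signed_power_mult mult_minus_right)
    also have "\<dots> = (- 1) ^ j * a ^ (3 * j * j + 2 * j)"
      using 3 by (simp add: algebra_simps minus_one_power_iff flip: power_Suc)
    finally have A: "h (3 * j + 1) = (- 1) ^ j * a ^ (3 * j * j + 2 * j)" .
    have "h (3 * j + 2) * h 2 = ?q * (- (?p * ?r ^ 2))"
      using eds_even_recursion[OF eds, of "3 * i + 4"] ih z
      unfolding idx by (simp add: add.commute)
    also have "\<dots> = - ((- 1) ^ (i + 1 + i + (i + 1) * 2) *
        a ^ (3 * (i + 1) * (i + 1) + 2 * (i + 1) + (3 * i * i + 4 * i + 1) +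
        (3 * (i + 1) * (i + 1) + 4 * (i + 1) + 1) * 2))"
      by (simp only: signed_power_mult_mult mult_minus_right)
    \<comment> \<open>One factor a is split off to be cancelled against \<open>h 2\<close>.\<close>
    also have "\<dots> = (- 1) ^ j * a ^ (3 * j * j + 4 * j + 1) * a"
      using 3 by (simp add: algebra_simps minus_one_power_iff flip: power_Suc)
    finally show ?thesis using A cancel by blast
  next
    case (4 i)
    \<comment> \<open>For odd j both recursions are used at k = 3i + 5, and now the second product
      vanishes.\<close>
    let ?p = "(- 1) ^ (i + 1) * a ^ (3 * (i + 1) * (i + 1) + 2 * (i + 1))"
    let ?q = "(- 1) ^ (i + 1) * a ^ (3 * (i + 1) * (i + 1) + 4 * (i + 1) + 1)"
    let ?r = "(- 1) ^ (i + 2) * a ^ (3 * (i + 2) * (i + 2) + 2 * (i + 2))"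
    have ih: "h (3 * i + 4) = ?p" "h (3 * i + 5) = ?q" "h (3 * i + 7) = ?r"
      using less.IH[of "i + 1"] less.IH[of "i + 2"] 4 by (simp_all add: add.commute)
    have idx: "2 * (3 * i + 5) = 3 * j + 1" "2 * (3 * i + 5) + 1 = 3 * j + 2"
      using 4 by simp_all
    have z: "h (3 * i + 3) = 0" "h (3 * i + 6) = 0"
      by (intro zero; presburger)+
    have "h (3 * j + 2) = ?r * ?q ^ 3"
      using eds_odd_recursion[OF eds h1, of "3 * i + 5"] ih z
      unfolding idx by (simp add: add.commute)
    also have "\<dots> = (- 1) ^ (i + 2 + (i + 1) * 3) *
        a ^ (3 * (i + 2) * (i + 2) + 2 * (i + 2) +
        (3 * (i + 1) * (i + 1) + 4 * (i + 1) + 1) * 3)"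
      by (simp only: signed_power_mult mult_minus_right)
    also have "\<dots> = (- 1) ^ j * a ^ (3 * j * j + 4 * j + 1)"
      using 4 by (simp add: algebra_simps minus_one_power_iff flip: power_Suc)
    finally have A: "h (3 * j + 2) = (- 1) ^ j * a ^ (3 * j * j + 4 * j + 1)" .
    have "h (3 * j + 1) * h 2 = ?q * (?r * ?p ^ 2)"
      using eds_even_recursion[OF eds, of "3 * i + 5"] ih z
      unfolding idx by (simp add: add.commute)
    also have "\<dots> = (- 1) ^ (i + 1 + (i + 2) + (i + 1) * 2) *
        a ^ (3 * (i + 1) * (i + 1) + 4 * (i + 1) + 1 +
        (3 * (i + 2) * (i + 2) + 2 * (i + 2)) + (3 * (i + 1) * (i + 1) + 2 * (i + 1)) * 2)"
      by (simp only: signed_power_mult_mult mult_minus_right)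
    also have "\<dots> = (- 1) ^ j * a ^ (3 * j * j + 2 * j) * a"
      using 4 by (simp add: algebra_simps minus_one_power_iff flip: power_Suc)
    finally show ?thesis using A cancel by blast
  qed
qed

theorem theorem3p3:
  "(\<forall>(b::int) (h::nat \<Rightarrow> int).
      elliptic_divisibility_sequence h \<and>
      h 0 = 0 \<and> h 1 = 1 \<and> h 2 = 0 \<and> h 3 = - (b ^ 2) \<and> h 4 = 0 \<longrightarrow>
      (\<forall>n::nat. n > 0 \<and> odd n \<longrightarrow>
         h n = (if n mod 8 \<in> {1, 5} then 1 else - 1) * b ^ ((n ^ 2 - 1) div 4))) \<and>
   (\<forall>(a\<^sub>3::int) (h::nat \<Rightarrow> int).
      elliptic_divisibility_sequence h \<and>
      h 0 = 0 \<and> h 1 = 1 \<and> h 2 = a\<^sub>3 \<and> h 3 = 0 \<and> h 4 = - (a\<^sub>3 ^ 5) \<longrightarrow>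
      (\<forall>n::nat. n > 0 \<and> \<not> 3 dvd n \<longrightarrow>
         h n = (if n mod 6 \<in> {1, 2} then 1 else - 1) * a\<^sub>3 ^ ((n ^ 2 - 1) div 3)))"
proof (intro conjI allI impI; elim conjE)
  fix b :: int and h :: "nat \<Rightarrow> int" and n :: nat
  assume eds: "elliptic_divisibility_sequence h"
    and h: "h 1 = 1" "h 2 = 0" "h 3 = - (b ^ 2)" and "odd n"
  then obtain j where j: "n = 2 * j + 1" by (elim oddE)
  have "(n ^ 2 - 1) div 4 = j * j + j"
    using j by (simp add: power2_eq_square algebra_simps)
  moreover have "n mod 8 \<in> {1, 5} \<longleftrightarrow> even j"
    unfolding j insert_iff empty_iff by presburger
  ultimately show "h n = (if n mod 8 \<in> {1, 5} then 1 else - 1) * b ^ ((n ^ 2 - 1) div 4)"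
    using eds_two_torsion[OF eds h, of j] j by simp
next
  fix a :: int and h :: "nat \<Rightarrow> int" and n :: nat
  assume eds: "elliptic_divisibility_sequence h"
    and h: "h 1 = 1" "h 2 = a" "h 3 = 0" "h 4 = - (a ^ 5)" and n: "0 < n" "\<not> 3 dvd n"
  have "n = 3 * (n div 3) + 1 \<or> n = 3 * (n div 3) + 2"
    using n(2) by presburger
  then obtain j where j: "n = 3 * j + 1 \<or> n = 3 * j + 2" by blast
  \<comment> \<open>Modulo 6, 3j is 0 for even j and 3 for odd j, so n leaves remainder 1 or 2 in
    the first case and 4 or 5 in the second.\<close>
  have sgn: "n mod 6 \<in> {1, 2} \<longleftrightarrow> even j"
    using j unfolding insert_iff empty_iff by presburger
  have ex: "(n ^ 2 - 1) div 3 = (if n = 3 * j + 1 then 3 * j * j + 2 * j else 3 * j * j + 4 * j + 1)"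
    using j by (auto simp: power2_eq_square algebra_simps)
  show "h n = (if n mod 6 \<in> {1, 2} then 1 else - 1) * a ^ ((n ^ 2 - 1) div 3)"
  proof (cases "a = 0")
    case False
    then show ?thesis
      using eds_three_torsion[OF eds h False, of j] j unfolding sgn ex by auto
  next
    case True
    \<comment> \<open>At n = 1 the exponent is 0 and \<open>0 ^ 0 = 1\<close> gives the right value.
      For every other n the exponent must be shown nonzero, so that the power of 0 vanishes as
      \<open>h n\<close> does.\<close>
    show ?thesis
    proof (cases "n = 1")
      case True
      then show ?thesis using h(1) by simp
    next
      case False
      then have "h n = 0"
        using eds_eq_zero_beyond_one[OF eds h(1) _ h(3)] h(2) \<open>a = 0\<close> n(1) by simp
      moreover have "(n ^ 2 - 1) div 3 \<noteq> 0"
        using j False unfolding ex by auto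
      ultimately show ?thesis using \<open>a = 0\<close> by simp
    qed
  qed
qed

end
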